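(* For every $n\ge2$ and every complex number $x$, \[\mathcal{B}_n(x)^{-1}=\mathcal{M}_n(x)^{-1}\mathcal{B}_n^{-1}\qquad\text{and}\qquad \mathcal{E}_n(x)^{-1}=\mathcal{M}_n(x)^{-1}\mathcal{E}_n^{-1},\] where $\mathcal{B}_n=\mathcal{B}_n(0)$ and $\mathcal{E}_n=\mathcal{E}_n(0)$.
   Context: The Mersenne numbers are $M_n=2^n-1$ ($n\ge 0$). The $M$-factorial is $M_0!=1$, $M_n!=M_nM_{n-1}!$ for $n\ge1$. The $M$-binomial coefficients are $\binom{n}{k}_M=\frac{M_n!}{M_k!M_{n-k}!}$ for $n\ge k\ge 0$ and $\binom nk_M=0$ for $k>n$. The $M$-exponential is $e_M^{xt}=\sum_{n\ge0}x^n\frac{t^n}{M_n!}$. The Mersenne-Bernoulli and Mersenne-Euler polynomials are defined (as power series in $t$) by $\frac{t e_M^{xt}}{e_M^t-1}=\sum_{n\ge0}B_{n,M}(x)\frac{t^n}{M_n!}$ and $\frac{2 e_M^{xt}}{e_M^t+1}=\sum_{n\ge0}E_{n,M}(x)\frac{t^n}{M_n!}$. Matrices ($n\times n$, indices $1\le i,j\le n$, all entries $0$ for $i<j$): for $i\ge j$, the Mersenne-Pascal matrix $\mathcal{M}_n(x)$ has entries $\binom{i-1}{j-1}_Mx^{i-j}$ (with $x^0=1$); the Mersenne-Bernoulli matrix $\mathcal{B}_n(x)$ has entries $\binom{i-1}{j-1}_MB_{i-j,M}(x)$; the Mersenne-Euler matrix $\mathcal{E}_n(x)$ has entries $\binom{i-1}{j-1}_ME_{i-j,M}(x)$.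 *)

theory Defs
  imports
    Complex_Main
    "HOL-Computational_Algebra.Formal_Power_Series"
    "Jordan_Normal_Form.Gauss_Jordan_Elimination"
begin

definition mersenne :: "nat \<Rightarrow> nat" where
  "mersenne n = 2 ^ n - 1"

fun mfact :: "nat \<Rightarrow> nat" where
  "mfact 0 = 1"
| "mfact (Suc n) = mersenne (Suc n) * mfact n"

definition mbinom :: "nat \<Rightarrow> nat \<Rightarrow> complex" where
  "mbinom n k =
    (if k \<le> n then of_nat (mfact n) / (of_nat (mfact k) * of_nat (mfact (n - k))) else 0)"

text \<open>The series \<open>e\<^sub>M\<close> with exponent \<open>x t\<close>, as a formal power series in \<open>t\<close>.\<close>

definition mexp :: "complex \<Rightarrow> complex fps" where
  "mexp x = Abs_fps (\<lambda>n. x ^ n / of_nat (mfact n))"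

text \<open>
  The values at a complex number \<open>x\<close> of the Mersenne-Bernoulli and Mersenne-Euler
  polynomials, read off from their generating functions.  In the Bernoulli case the
  divisor has vanishing constant term and nonzero linear term; the numerator is divisible
  by \<open>t\<close>, so the library's division of formal power series is exact
  (see \<open>mbernoulli_gf\<close> and \<open>meuler_gf\<close> below).
\<close>

definition mbernoulli :: "nat \<Rightarrow> complex \<Rightarrow> complex" where
  "mbernoulli n x = of_nat (mfact n) * fps_nth (fps_X * mexp x / (mexp 1 - 1)) n"

definition meuler :: "nat \<Rightarrow> complex \<Rightarrow> complex" where
  "meuler n x = of_nat (mfact n) * fps_nth (2 * mexp x / (mexp 1 + 1)) n"

text \<open>
  Matrix indices start at \<open>0\<close>, so the entry in position \<open>(i, j)\<close> here is the
  entry in position \<open>(i + 1, j + 1)\<close> under the usual numbering from \<open>1\<close>.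
\<close>

definition mpascal_mat :: "nat \<Rightarrow> complex \<Rightarrow> complex mat" where
  "mpascal_mat n x =
    mat n n (\<lambda>(i, j). if j \<le> i then mbinom i j * x ^ (i - j) else 0)"

definition mbernoulli_mat :: "nat \<Rightarrow> complex \<Rightarrow> complex mat" where
  "mbernoulli_mat n x =
    mat n n (\<lambda>(i, j). if j \<le> i then mbinom i j * mbernoulli (i - j) x else 0)"

definition meuler_mat :: "nat \<Rightarrow> complex \<Rightarrow> complex mat" where
  "meuler_mat n x =
    mat n n (\<lambda>(i, j). if j \<le> i then mbinom i j * meuler (i - j) x else 0)"

lemma mfact_pos: "mfact n > 0"
proof (induction n)
  case (Suc n)
  have "(1::nat) < 2 ^ Suc n"
    by (rule one_less_power) simp_all
  with Suc show ?case
    by (simp add: mersenne_def)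
qed simp

lemma mbernoulli_gf:
  "Abs_fps (\<lambda>n. mbernoulli n x / of_nat (mfact n)) * (mexp 1 - 1) = fps_X * mexp x"
proof -
  have nz: "mfact n \<noteq> 0" for n
    using mfact_pos[of n] by simp
  have c1: "fps_nth (mexp 1 - 1) 1 \<noteq> 0" and c0: "fps_nth (mexp 1 - 1) 0 = 0"
    by (simp_all add: mexp_def mersenne_def)
  have "subdegree (mexp 1 - 1) = 1"
    using c1 c0 by (intro subdegreeI) auto
  moreover have "subdegree (fps_X * mexp x) \<ge> 1"
    by (intro subdegree_geI) (auto simp: mexp_def fps_eq_iff intro!: exI[of _ 1])
  moreover have "mexp 1 - 1 \<noteq> 0"
    using c1 by auto
  ultimately have "mexp 1 - 1 dvd fps_X * mexp x"
    by (simp add: fps_dvd_iff)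
  moreover have "Abs_fps (\<lambda>n. mbernoulli n x / of_nat (mfact n)) = fps_X * mexp x / (mexp 1 - 1)"
    by (rule fps_ext) (simp add: mbernoulli_def nz)
  ultimately show ?thesis
    by simp
qed

lemma meuler_gf:
  "Abs_fps (\<lambda>n. meuler n x / of_nat (mfact n)) * (mexp 1 + 1) = 2 * mexp x"
proof -
  have nz: "mfact n \<noteq> 0" for n
    using mfact_pos[of n] by simp
  have "fps_nth (mexp 1 + 1) 0 \<noteq> 0"
    by (simp add: mexp_def)
  then have "mexp 1 + 1 dvd 2 * mexp x"
    by (metis fps_is_unit_iff unit_imp_dvd)
  moreover have "Abs_fps (\<lambda>n. meuler n x / of_nat (mfact n)) = 2 * mexp x / (mexp 1 + 1)"
    by (rule fps_ext) (simp add: meuler_def nz)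
  ultimately show ?thesis
    by simp
qed

text \<open>
  \<open>mat_inverse\<close> is option-valued; \<open>mat_inv\<close> is meaningful for matrices that satisfy
  \<open>invertible_mat\<close> only.
\<close>

definition mat_inv :: "complex mat \<Rightarrow> complex mat" where
  "mat_inv A = the (mat_inverse A)"

end

theory Submission
  imports Defs "Jordan_Normal_Form.Determinant"
begin

text \<open>
  Conjugating by the diagonal matrix of \<open>M\<close>-factorials turns all the matrices involved into
  lower triangular Toeplitz matrices, and these multiply like the power series of their
  coefficients.  So the claim is the inverse of the identity of generating functions
  \<open>F(x) = F(0) e\<^sub>M(x)\<close>, and a matrix is invertible if its series has nonzero constant term.
\<close>

text \<open>The quotient \<open>mfact i / mfact j\<close> is the conjugation by the diagonal matrix;
  it is also what \<open>mbinom i j\<close> leaves once its factor \<open>1 / mfact (i - j)\<close>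
  is absorbed into the coefficient of \<open>F\<close>.\<close>

definition mtoeplitz_mat :: "nat \<Rightarrow> complex fps \<Rightarrow> complex mat" where
  "mtoeplitz_mat n F =
    mat n n (\<lambda>(i, j). if j \<le> i then of_nat (mfact i) / of_nat (mfact j) * fps_nth F (i - j) else 0)"

lemma mtoeplitz_mat_carrier [simp]: "mtoeplitz_mat n F \<in> carrier_mat n n"
  by (simp add: mtoeplitz_mat_def)

lemma mtoeplitz_mat_one: "mtoeplitz_mat n 1 = 1\<^sub>m n"
  using mfact_pos by (intro eq_matI) (auto simp: mtoeplitz_mat_def less_imp_neq[symmetric])

lemma mtoeplitz_mat_mult:
  "mtoeplitz_mat n (F * G) = mtoeplitz_mat n F * mtoeplitz_mat n G"
proof (rule eq_matI)
  fix i j assume "i < dim_row (mtoeplitz_mat n F * mtoeplitz_mat n G)"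
    and "j < dim_col (mtoeplitz_mat n F * mtoeplitz_mat n G)"
  then have ij: "i < n" "j < n"
    by (simp_all add: mtoeplitz_mat_def)
  let ?c = "of_nat (mfact i) / of_nat (mfact j) :: complex"
  have "(mtoeplitz_mat n F * mtoeplitz_mat n G) $$ (i, j) =
      (\<Sum>k<n. mtoeplitz_mat n F $$ (i, k) * mtoeplitz_mat n G $$ (k, j))"
    using ij by (simp add: mtoeplitz_mat_def scalar_prod_def atLeast0LessThan)
  \<comment> \<open>Triangularity kills all terms outside \<open>j..i\<close>, and since
    \<open>i < n\<close> the truncation to size \<open>n\<close> loses nothing. The factors
    \<open>mfact k\<close> cancel.\<close>
  also have "\<dots> = (\<Sum>k\<in>{j..i}. ?c * (fps_nth G (k - j) * fps_nth F (i - k)))"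
    using ij mfact_pos
    by (intro sum.mono_neutral_cong_right)
       (auto simp: mtoeplitz_mat_def less_imp_neq[symmetric])
  \<comment> \<open>The shift \<open>m = k - j\<close> gives the Cauchy product, with
    \<open>G\<close> first because \<open>m\<close> indexes its coefficients. For
    \<open>i < j\<close> the sum is empty.\<close>
  also have "\<dots> = (if j \<le> i then ?c * fps_nth (G * F) (i - j) else 0)"
    by (auto simp: fps_mult_nth sum_distrib_left
        intro!: sum.reindex_bij_witness[of _ "\<lambda>m. m + j" "\<lambda>k. k - j"])
  also have "\<dots> = mtoeplitz_mat n (F * G) $$ (i, j)"
    using ij by (simp add: mtoeplitz_mat_def mult.commute[of G F])
  finally show "mtoeplitz_mat n (F * G) $$ (i, j) =
      (mtoeplitz_mat n F * mtoeplitz_mat n G) $$ (i, j)" ..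
qed (simp_all add: mtoeplitz_mat_def)

text \<open>A right inverse of a square matrix over a field is two-sided, which excludes the result
  \<open>None\<close>; any left inverse \<open>C\<close> then equals \<open>B\<close> by
  associativity.\<close>

lemma mat_inv_eqI:
  assumes A: "A \<in> carrier_mat n n" and B: "B \<in> carrier_mat n n" and AB: "A * B = 1\<^sub>m n"
  shows "mat_inv A = B"
proof (cases "mat_inverse A")
  case None
  have "A \<in> Units (ring_mat TYPE(complex) n ())"
    using A B AB mat_mult_left_right_inverse[OF A B AB] by (auto simp: Units_def ring_mat_def)
  with mat_inverse(1)[OF A None, of "()"] show ?thesis
    by blast
next
  case (Some C)
  then have C: "C \<in> carrier_mat n n" "C * A = 1\<^sub>m n"
    using mat_inverse(2)[OF A] by auto
  have "C = C * (A * B)"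
    using C AB by simp
  also have "\<dots> = C * A * B"
    by (rule assoc_mult_mat[symmetric]) (use A B C in auto)
  also have "\<dots> = B"
    using B C by simp
  finally show ?thesis
    using Some by (simp add: mat_inv_def)
qed

lemma mtoeplitz_mat_inverse:
  assumes "fps_nth F 0 \<noteq> 0"
  shows "mtoeplitz_mat n F * mtoeplitz_mat n (inverse F) = 1\<^sub>m n"
    and "mtoeplitz_mat n (inverse F) * mtoeplitz_mat n F = 1\<^sub>m n"
  using inverse_mult_eq_1[OF assms] inverse_mult_eq_1'[OF assms]
  by (simp_all add: mtoeplitz_mat_one flip: mtoeplitz_mat_mult)

lemma invertible_mtoeplitz_mat:
  assumes "fps_nth F 0 \<noteq> 0"
  shows "invertible_mat (mtoeplitz_mat n F)"
proof -
  have "dim_row (mtoeplitz_mat n G) = n" "dim_col (mtoeplitz_mat n G) = n" for G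
    by (simp_all add: mtoeplitz_mat_def)
  then show ?thesis
    using mtoeplitz_mat_inverse[OF assms, of n]
    by (auto simp: invertible_mat_def inverts_mat_def)
qed

lemma mat_inv_mtoeplitz_mat:
  assumes "fps_nth F 0 \<noteq> 0"
  shows "mat_inv (mtoeplitz_mat n F) = mtoeplitz_mat n (inverse F)"
  using mtoeplitz_mat_inverse(1)[OF assms] by (intro mat_inv_eqI) simp_all

text \<open>These matrices commute because power series do, so the inverses may be written in either
  order.\<close>

lemma mat_inv_mtoeplitz_mat_mult:
  assumes "fps_nth F 0 \<noteq> 0" "fps_nth G 0 \<noteq> 0"
  shows "mat_inv (mtoeplitz_mat n (F * G)) =
    mat_inv (mtoeplitz_mat n G) * mat_inv (mtoeplitz_mat n F)"
  using assms by (simp add: mat_inv_mtoeplitz_mat fps_inverse_mult mult.commute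
      flip: mtoeplitz_mat_mult)

lemma mpascal_mat_eq: "mpascal_mat n x = mtoeplitz_mat n (mexp x)"
  by (intro eq_matI) (auto simp: mpascal_mat_def mtoeplitz_mat_def mbinom_def mexp_def)

definition mbernoulli_fps :: "complex \<Rightarrow> complex fps" where
  "mbernoulli_fps x = Abs_fps (\<lambda>n. mbernoulli n x / of_nat (mfact n))"

definition meuler_fps :: "complex \<Rightarrow> complex fps" where
  "meuler_fps x = Abs_fps (\<lambda>n. meuler n x / of_nat (mfact n))"

lemma mbernoulli_mat_eq: "mbernoulli_mat n x = mtoeplitz_mat n (mbernoulli_fps x)"
  by (intro eq_matI)
    (auto simp: mbernoulli_mat_def mtoeplitz_mat_def mbinom_def mbernoulli_fps_def)

lemma meuler_mat_eq: "meuler_mat n x = mtoeplitz_mat n (meuler_fps x)"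
  by (intro eq_matI) (auto simp: meuler_mat_def mtoeplitz_mat_def mbinom_def meuler_fps_def)

lemma mexp_nth_0 [simp]: "fps_nth (mexp x) 0 = 1"
  by (simp add: mexp_def)

lemma mexp_0: "mexp 0 = 1"
  by (rule fps_ext) (simp add: mexp_def)

text \<open>In the generating function \<open>x\<close> enters only through \<open>mexp x\<close>,
  and \<open>mexp 0 = 1\<close>. The divisor \<open>mexp 1 - 1\<close> is not a unit, but it is
  nonzero and can be cancelled in an integral domain.\<close>

lemma mbernoulli_fps_eq: "mbernoulli_fps x = mbernoulli_fps 0 * mexp x"
proof -
  have "fps_nth (mexp 1 - 1) 1 = 1"
    by (simp add: mexp_def mersenne_def)
  then have "mexp 1 - 1 \<noteq> 0"
    by auto
  moreover have "mbernoulli_fps x * (mexp 1 - 1) = mbernoulli_fps 0 * mexp x * (mexp 1 - 1)"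
    using mbernoulli_gf[of x] mbernoulli_gf[of 0]
    by (simp add: mbernoulli_fps_def mexp_0 mult.commute mult.left_commute)
  ultimately show ?thesis
    by simp
qed

lemma meuler_fps_eq: "meuler_fps x = meuler_fps 0 * mexp x"
proof -
  have "fps_nth (mexp 1 + 1) 0 = 2"
    by simp
  then have "mexp 1 + 1 \<noteq> 0"
    by (metis fps_zero_nth zero_neq_numeral)
  moreover have "meuler_fps x * (mexp 1 + 1) = meuler_fps 0 * mexp x * (mexp 1 + 1)"
    using meuler_gf[of x] meuler_gf[of 0]
    by (simp add: meuler_fps_def mexp_0 mult.commute mult.left_commute)
  ultimately show ?thesis
    by simp
qed

text \<open>Since \<open>mexp 1 - 1\<close> has no constant term, the coefficient of
  \<open>fps_X\<close> in \<open>mbernoulli_gf\<close> involves only this constant term on the left;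
  on the right it is 1.\<close>

lemma mbernoulli_fps_nth_0: "fps_nth (mbernoulli_fps x) 0 \<noteq> 0"
proof
  assume "fps_nth (mbernoulli_fps x) 0 = 0"
  then have "fps_nth (mbernoulli_fps x * (mexp 1 - 1)) 1 = 0"
    by (simp add: fps_mult_nth)
  then show False
    using mbernoulli_gf[of x] by (simp add: mbernoulli_fps_def)
qed

text \<open>Here the constant terms of \<open>meuler_gf\<close> suffice: the right side has
  2.\<close>

lemma meuler_fps_nth_0: "fps_nth (meuler_fps x) 0 \<noteq> 0"
proof
  assume "fps_nth (meuler_fps x) 0 = 0"
  then have "fps_nth (meuler_fps x * (mexp 1 + 1)) 0 = 0"
    by simp
  then show False
    using meuler_gf[of x] by (simp add: meuler_fps_def)
qed

theorem corollary3p4: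
  fixes n :: nat and x :: complex
  assumes "n \<ge> 2"
  shows "invertible_mat (mpascal_mat n x)
    \<and> (invertible_mat (mbernoulli_mat n x) \<and> invertible_mat (mbernoulli_mat n 0)
       \<and> mat_inv (mbernoulli_mat n x) = mat_inv (mpascal_mat n x) * mat_inv (mbernoulli_mat n 0))
    \<and> (invertible_mat (meuler_mat n x) \<and> invertible_mat (meuler_mat n 0)
       \<and> mat_inv (meuler_mat n x) = mat_inv (mpascal_mat n x) * mat_inv (meuler_mat n 0))"
proof (intro conjI)
  show "mat_inv (mbernoulli_mat n x) = mat_inv (mpascal_mat n x) * mat_inv (mbernoulli_mat n 0)"
    unfolding mbernoulli_mat_eq mpascal_mat_eq
    by (subst mbernoulli_fps_eq) (simp add: mat_inv_mtoeplitz_mat_mult mbernoulli_fps_nth_0)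
  show "mat_inv (meuler_mat n x) = mat_inv (mpascal_mat n x) * mat_inv (meuler_mat n 0)"
    unfolding meuler_mat_eq mpascal_mat_eq
    by (subst meuler_fps_eq) (simp add: mat_inv_mtoeplitz_mat_mult meuler_fps_nth_0)
qed (simp_all add: mpascal_mat_eq mbernoulli_mat_eq meuler_mat_eq invertible_mtoeplitz_mat
    mbernoulli_fps_nth_0 meuler_fps_nth_0)

end
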